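(* Let $\Sigma$ be a finite alphabet partitioned into two classes $A$ and $B$, and let $t=((C_1,k_1),(C_2,k_2),\ldots,(C_m,k_m))$ be an alternating sequence over $(\Sigma;A,B)$. Then the block language $L_t\subseteq\Sigma^*$ is regular.
   Context: Alternating sequence over $(\Sigma;A,B)$: a sequence $t=((C_1,k_1),\ldots,(C_m,k_m))$ where $k_1,\ldots,k_m$ are positive integers, each $C_i$ is a finite multi-set of symbols of $\Sigma$ with cardinality (counted with multiplicity) $|C_i|=k_i$, and, writing $\{C_i\}$ for the set of distinct symbols of $C_i$, either ($\{C_i\}\subseteq A$ for all odd $i$ and $\{C_i\}\subseteq B$ for all even $i$), or ($\{C_i\}\subseteq B$ for all odd $i$ and $\{C_i\}\subseteq A$ for all even $i$). Block language: with $\Sigma_{C_i}=\{C_i\}$, $$L_t=(\Sigma_{C_1})^{k_1}(\Sigma_{C_2})^{k_2}\cdots(\Sigma_{C_m})^{k_m}\subseteq\Sigma^{K},\qquad K=\sum_{i=1}^m k_i,$$ where $(\Sigma_{C_i})^{k_i}$ is the set of all strings of length $k_i$ over $\Sigma_{C_i}$ and juxtaposition denotes concatenation of languages. A language is regular if it is the language accepted by some deterministic finite automaton. *)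

theory Defs
  imports "HOL-Library.Multiset"
begin

section \<open>Regular languages\<close>

record ('a, 'q) dfa =
  states :: "'q set"
  init :: 'q
  final :: "'q set"
  delta :: "'q \<Rightarrow> 'a \<Rightarrow> 'q"

definition is_dfa :: "'a set \<Rightarrow> ('a, 'q) dfa \<Rightarrow> bool" where
  "is_dfa \<Sigma> M \<longleftrightarrow>
     finite (states M) \<and> init M \<in> states M \<and> final M \<subseteq> states M \<and>
     (\<forall>q\<in>states M. \<forall>a\<in>\<Sigma>. delta M q a \<in> states M)"

definition dfa_language :: "'a set \<Rightarrow> ('a, 'q) dfa \<Rightarrow> 'a list set" where
  "dfa_language \<Sigma> M = {w \<in> lists \<Sigma>. foldl (delta M) (init M) w \<in> final M}"

text \<open>
  The states are natural numbers because one cannot quantify existentially over a state type.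
  This loses no generality: see \<open>regular_language_dfa_language\<close> below.
\<close>

definition regular_language :: "'a set \<Rightarrow> 'a list set \<Rightarrow> bool" where
  "regular_language \<Sigma> L \<longleftrightarrow>
     (\<exists>M :: ('a, nat) dfa. is_dfa \<Sigma> M \<and> dfa_language \<Sigma> M = L)"

lemma regular_language_dfa_language:
  fixes M :: "('a, 'q) dfa"
  assumes M: "is_dfa \<Sigma> M"
  shows "regular_language \<Sigma> (dfa_language \<Sigma> M)"
proof -
  have fin: "finite (states M)" and i: "init M \<in> states M" and f: "final M \<subseteq> states M"
    and d: "\<And>q a. q \<in> states M \<Longrightarrow> a \<in> \<Sigma> \<Longrightarrow> delta M q a \<in> states M"
    using M by (auto simp: is_dfa_def)
  obtain e :: "'q \<Rightarrow> nat" where e: "inj_on e (states M)"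
    using finite_imp_inj_to_nat_seg[OF fin] by blast
  define g where "g = the_inv_into (states M) e"
  have g: "g (e q) = q" if "q \<in> states M" for q
    using the_inv_into_f_f[OF e that] by (simp add: g_def)
  define N where "N = \<lparr>states = e ` states M, init = e (init M), final = e ` final M,
    delta = (\<lambda>n a. e (delta M (g n) a))\<rparr>"
  have "is_dfa \<Sigma> N"
    using fin i f d by (auto simp: is_dfa_def N_def g)
  moreover have run: "foldl (delta N) (e q) w = e (foldl (delta M) q w) \<and>
      foldl (delta M) q w \<in> states M"
    if "q \<in> states M" "w \<in> lists \<Sigma>" for q w
    using that(2,1) by (induction w arbitrary: q) (auto simp: N_def g d)
  have "dfa_language \<Sigma> N = dfa_language \<Sigma> M"
  proof -
    have "foldl (delta N) (init N) w \<in> final N \<longleftrightarrow> foldl (delta M) (init M) w \<in> final M"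
      if "w \<in> lists \<Sigma>" for w
      using run[OF i that] inj_on_image_mem_iff[OF e _ f] by (simp add: N_def)
    then show ?thesis by (auto simp: dfa_language_def)
  qed
  ultimately show ?thesis
    unfolding regular_language_def by blast
qed


section \<open>Alternating sequences and their block languages\<close>

text \<open>The \<open>i\<close>-th term of a sequence, counted from 1, is \<open>t ! (i - 1)\<close>.\<close>

definition alternating_sequence ::
    "'a set \<Rightarrow> 'a set \<Rightarrow> 'a set \<Rightarrow> ('a multiset \<times> nat) list \<Rightarrow> bool" where
  "alternating_sequence \<Sigma> A B t \<longleftrightarrow>
     (\<forall>(C, k)\<in>set t. 0 < k \<and> set_mset C \<subseteq> \<Sigma> \<and> size C = k) \<and>
     ((\<forall>i\<in>{1..length t}. (odd i \<longrightarrow> set_mset (fst (t ! (i - 1))) \<subseteq> A) \<and>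
                          (even i \<longrightarrow> set_mset (fst (t ! (i - 1))) \<subseteq> B)) \<or>
      (\<forall>i\<in>{1..length t}. (odd i \<longrightarrow> set_mset (fst (t ! (i - 1))) \<subseteq> B) \<and>
                          (even i \<longrightarrow> set_mset (fst (t ! (i - 1))) \<subseteq> A)))"

definition strings_of_length :: "'a set \<Rightarrow> nat \<Rightarrow> 'a list set" where
  "strings_of_length S k = {w. set w \<subseteq> S \<and> length w = k}"

definition lang_concat :: "'a list set \<Rightarrow> 'a list set \<Rightarrow> 'a list set" where
  "lang_concat L L' = {u @ v | u v. u \<in> L \<and> v \<in> L'}"

definition block_language :: "('a multiset \<times> nat) list \<Rightarrow> 'a list set" where
  "block_language t =
     foldr lang_concat (map (\<lambda>(C, k). strings_of_length (set_mset C) k) t) {[]}"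

lemma block_language_subset:
  assumes "alternating_sequence \<Sigma> A B t"
  shows "block_language t \<subseteq> strings_of_length \<Sigma> (\<Sum>(C, k)\<leftarrow>t. k)"
proof -
  have "\<forall>(C, k)\<in>set t. set_mset C \<subseteq> \<Sigma>"
    using assms by (auto simp: alternating_sequence_def)
  then show ?thesis
  proof (induction t)
    case Nil
    then show ?case by (simp add: block_language_def strings_of_length_def)
  next
    case (Cons p t)
    obtain C k where p: "p = (C, k)" by (cases p)
    have C: "set_mset C \<subseteq> \<Sigma>" using Cons.prems by (simp add: p)
    have "block_language t \<subseteq> strings_of_length \<Sigma> (\<Sum>(C, k)\<leftarrow>t. k)"
      using Cons.IH Cons.prems by simp
    moreover have "block_language (p # t) =
        lang_concat (strings_of_length (set_mset C) k) (block_language t)"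
      by (simp add: block_language_def p)
    ultimately show ?case
      using C by (auto simp: p lang_concat_def strings_of_length_def subset_iff)
  qed
qed

end

(* A block language is finite, and a finite language with words of length at most n is accepted by
   the automaton that remembers the first n + 1 letters of its input. *)
theory Submission
  imports Defs
begin

text \<open>All words of the block language have one length, the sum of the \<open>k\<close>, over
  the finite \<open>\<Sigma>\<close>; by \<open>block_language_subset\<close> it is finite.
  \<open>regular_language_finite\<close> concludes, since a bounded prefix fits in finitely many
  states.\<close>

lemma regular_language_finite:
  assumes \<Sigma>: "finite \<Sigma>" and L: "finite L" "L \<subseteq> lists \<Sigma>"
  shows "regular_language \<Sigma> L"
proof -
  obtain n where n: "\<And>w. w \<in> L \<Longrightarrow> length w \<le> n"
    using finite_nat_set_iff_bounded_le[of "length ` L"] L(1) by auto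
  \<comment> \<open>Keeping only \<open>n\<close> letters would confuse a longer word with its
    prefix, which may lie in \<open>L\<close>.\<close>
  define M where "M = \<lparr>states = {w. set w \<subseteq> \<Sigma> \<and> length w \<le> Suc n}, init = [], final = L,
    delta = (\<lambda>w a. take (Suc n) (w @ [a]))\<rparr>"
  have "is_dfa \<Sigma> M"
    using finite_lists_length_le[OF \<Sigma>, of "Suc n"] n L(2)
    by (fastforce simp: is_dfa_def M_def le_Suc_eq dest: in_set_takeD)
  moreover have "foldl (delta M) (init M) w = take (Suc n) w" for w
    by (induction w rule: rev_induct) (auto simp: M_def min_def)
  then have "dfa_language \<Sigma> M = {w \<in> lists \<Sigma>. take (Suc n) w \<in> L}"
    by (simp add: dfa_language_def M_def)
  moreover have "take (Suc n) w \<in> L \<longleftrightarrow> w \<in> L" for w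
  proof (cases "length w \<le> n")
    case False
    \<comment> \<open>Both sides are false: \<open>w\<close> and its truncation are longer than
      \<open>n\<close>.\<close>
    then show ?thesis using n[of w] n[of "take (Suc n) w"] by auto
  qed simp
  \<comment> \<open>The states of \<open>M\<close> are lists, so they are transferred to
    \<open>nat\<close>.\<close>
  ultimately show ?thesis
    using regular_language_dfa_language[of \<Sigma> M] L(2) by (simp add: Collect_conj_eq Int_absorb1)
qed

theorem theorem5p1:
  fixes \<Sigma> A B :: "'a set" and t :: "('a multiset \<times> nat) list"
  assumes "finite \<Sigma>"
    and "A \<union> B = \<Sigma>" and "A \<inter> B = {}"
    and "alternating_sequence \<Sigma> A B t"
  shows "regular_language \<Sigma> (block_language t)"
proof (rule regular_language_finite)
  note subset = block_language_subset[OF assms(4)]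
  show "finite (block_language t)"
    using finite_subset[OF subset] finite_lists_length_eq[OF assms(1)]
    by (simp add: strings_of_length_def)
  show "block_language t \<subseteq> lists \<Sigma>"
    using subset by (auto simp: strings_of_length_def)
qed (fact assms(1))

end
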